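(* Let $f:\mathbb{R}\to\mathbb{R}$ be the $1$-periodic function with $f(x)=x-2^x$ for $x\in[0,1]$. There is a function $\varepsilon(n)\to 0$ (as $n\to\infty$) such that for all sufficiently large $n$ there is a tree $T$ with $n$ vertices satisfying $$\mu_T\ge n-2\log_2(0.9n)+f\big(2\log_2(0.9n)\big)-\varepsilon(n).$$
   Context: A subtree of a tree $T$ is a (nonempty) induced connected subgraph; the mean subtree order $\mu_T$ is the average number of vertices of a subtree of $T$, averaged over all subtrees. *)

theory Defs
  imports Complex_Main "Graph_Theory.Digraph_Component"
begin

text \<open>
  A finite simple graph is a symmetric loop-free digraph (\<open>pair_graph\<close>): each undirected
  edge is a pair of opposite arcs. In such a digraph the walk \<open>a, b, a\<close> counts as a
  \<open>cycle\<close>, so no graph with an edge satisfies the predicate \<open>tree\<close> of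
  \<^theory>\<open>Graph_Theory.Digraph_Component\<close>. Undirected cycles are exactly the \<open>cycle\<close>s
  with at least three arcs, and only those are forbidden here.
\<close>
definition is_tree :: "'a pair_pre_digraph \<Rightarrow> bool" where
  "is_tree T \<longleftrightarrow> pair_graph T \<and> Digraph_Component.connected (with_proj T) \<and>
     \<not> (\<exists>p. pre_digraph.cycle (with_proj T) p \<and> 3 \<le> length p)"

text \<open>Nonemptiness is part of \<^const>\<open>Digraph_Component.connected\<close>.\<close>
definition subtrees :: "'a pair_pre_digraph \<Rightarrow> 'a pair_pre_digraph set" where
  "subtrees T = {S. induced_subgraph (with_proj S) (with_proj T) \<and> Digraph_Component.connected (with_proj S)}"

definition mean_subtree_order :: "'a pair_pre_digraph \<Rightarrow> real" where
  "mean_subtree_order T =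
     (\<Sum>S\<in>subtrees T. real (card (pverts S))) / real (card (subtrees T))"

end

theory Submission
  imports Defs
begin

text \<open>
  The tree is a caterpillar with \<open>2x\<close> leaves, where \<open>x = \<lfloor>2 log\<^sub>2 (0.9 n)\<rfloor>\<close>: \<open>x - 2\<close> leaves sit at
  each end of the spine and four more at relative positions \<open>1/9, 1/3, 2/3, 8/9\<close>. The \<open>2\<^sup>2\<^sup>x\<close>
  subtrees containing the spine miss \<open>x\<close> vertices on average. A subtree that misses an initial
  (or final) segment of \<open>d\<close> spine vertices also loses the leaves attached there, and summing \<open>d\<close>
  with the resulting weights over both ends costs a further \<open>(29/36) n\<^sup>2 2\<^sup>-\<^sup>x + o(1)\<close> vertices; all
  other subtrees contribute \<open>o(1)\<close>. The four inner leaves bring the constant from \<open>1\<close> down to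
  \<open>29/36 < 0.81 = 0.9\<^sup>2\<close>, and \<open>x + 0.81 n\<^sup>2 2\<^sup>-\<^sup>x = L - f L\<close> for \<open>L = 2 log\<^sub>2 (0.9 n)\<close>.
\<close>

section \<open>Trees given by a parent function\<close>

text \<open>A path from \<open>x\<close> to \<open>y\<close> in the symmetric closure has to leave
  \<open>X\<close> at some step. The arc may point either way, since the closure forgets
  directions.\<close>

lemma connected_cut:
  assumes con: "Digraph_Component.connected (with_proj S)"
    and X: "X \<subseteq> pverts S" "x \<in> X" "y \<in> pverts S - X"
  obtains u v where "u \<in> X" "v \<in> pverts S - X" "(u, v) \<in> parcs S \<or> (v, u) \<in> parcs S"
proof -
  have "(x, y) \<in> rtrancl_on (pverts S) (parcs (mk_symmetric (with_proj S)))"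
    using con X unfolding Digraph_Component.connected_def strongly_connected_def reachable_def by auto
  then have "y \<in> X \<or> (\<exists>u\<in>X. \<exists>v\<in>pverts S - X. (u, v) \<in> parcs S \<or> (v, u) \<in> parcs S)"
  proof (induction rule: rtrancl_on_induct)
    case base
    then show ?case using X by blast
  next
    case (step y z)
    then show ?case unfolding parcs_mk_symmetric with_proj_simps by fastforce
  qed
  with X that show ?thesis by blast
qed

text \<open>The root is \<open>0\<close>, whose value \<open>p 0\<close> is ignored. The vertex set
  is a parameter, so that an induced subgraph is again a \<open>parent_graph\<close> with the same
  \<open>p\<close>.\<close>

definition parent_graph :: "nat set \<Rightarrow> (nat \<Rightarrow> nat) \<Rightarrow> nat pair_pre_digraph" where
  "parent_graph V p = \<lparr> pverts = V,
     parcs = {(u, v). u \<in> V \<and> v \<in> V \<and> (0 < u \<and> v = p u \<or> 0 < v \<and> u = p v)} \<rparr>"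

lemma pverts_parent_graph [simp]: "pverts (parent_graph V p) = V"
  by (simp add: parent_graph_def)

lemma parcs_parent_graph:
  "(u, v) \<in> parcs (parent_graph V p) \<longleftrightarrow> u \<in> V \<and> v \<in> V \<and> (0 < u \<and> v = p u \<or> 0 < v \<and> u = p v)"
  by (simp add: parent_graph_def)

lemma wf_digraph_parent_graph: "wf_digraph (with_proj (parent_graph V p))"
  by (rule wf_digraph.intro) (auto simp: parent_graph_def)

lemma symmetric_parent_graph: "symmetric (with_proj (parent_graph V p))"
  unfolding symmetric_def with_proj_simps sym_def by (simp add: parcs_parent_graph) blast

lemma pair_graph_parent_graph:
  assumes "finite V" "\<And>v. 0 < v \<Longrightarrow> p v < v"
  shows "pair_graph (parent_graph V p)"
proof
  show "finite (parcs (parent_graph V p))"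
    by (rule finite_subset[of _ "V \<times> V"]) (use assms(1) in \<open>auto simp: parent_graph_def\<close>)
  show "symmetric (with_proj (parent_graph V p))" by (rule symmetric_parent_graph)
  fix e assume e: "e \<in> parcs (parent_graph V p)"
  obtain u v where uv: "e = (u, v)" by (cases e)
  show "fst e \<in> pverts (parent_graph V p)" "snd e \<in> pverts (parent_graph V p)"
    using e by (simp_all add: uv parcs_parent_graph)
  have "0 < u \<and> v = p u \<or> 0 < v \<and> u = p v" using e by (simp add: uv parcs_parent_graph)
  with assms(2)[of u] assms(2)[of v] show "fst e \<noteq> snd e" by (auto simp: uv)
qed (use assms(1) in simp)

text \<open>Iterating the strictly decreasing parent map joins every vertex to \<open>0\<close>;
  symmetry reverses one of two such paths.\<close>

lemma connected_parent_graph: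
  assumes "\<And>v. 0 < v \<Longrightarrow> p v < v" "0 \<in> V" "\<And>v. v \<in> V \<Longrightarrow> 0 < v \<Longrightarrow> p v \<in> V"
  shows "Digraph_Component.connected (with_proj (parent_graph V p))"
proof -
  note wf = wf_digraph_parent_graph[of V p] and sym = symmetric_parent_graph[of V p]
  have to0: "v \<in> V \<Longrightarrow> v \<rightarrow>\<^sup>*\<^bsub>with_proj (parent_graph V p)\<^esub> 0" for v
  proof (induction v rule: less_induct)
    case (less v)
    show ?case
    proof (cases "v = 0")
      case True
      then show ?thesis using assms(2) by (simp add: reachable_def)
    next
      case False
      then have "(v, p v) \<in> parcs (parent_graph V p)"
        using less.prems assms(3) by (simp add: parcs_parent_graph)
      moreover have "p v \<rightarrow>\<^sup>*\<^bsub>with_proj (parent_graph V p)\<^esub> 0"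
        using less.IH[of "p v"] False assms(1,3) less.prems by simp
      ultimately show ?thesis
        by (intro wf_digraph.adj_reachable_trans[OF wf, of v "p v"]) simp_all
    qed
  qed
  have "u \<rightarrow>\<^sup>*\<^bsub>with_proj (parent_graph V p)\<^esub> v" if "u \<in> V" "v \<in> V" for u v
    using to0[OF that(1)] symmetric_reachable[OF sym to0[OF that(2)]]
    by (rule wf_digraph.reachable_trans[OF wf])
  then show ?thesis
    using assms(2) wf_digraph.reachable_mk_symmetric_eq[OF wf sym]
    unfolding Digraph_Component.connected_def strongly_connected_def by auto
qed

section \<open>Walks as arc lists, and absence of long cycles\<close>

lemma pcas_nth:
  assumes "pcas u c v" "Suc i < length c"
  shows "fst (c ! Suc i) = snd (c ! i)"
  using assms
proof (induction c arbitrary: u i)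
  case (Cons e c)
  then show ?case by (cases i; cases c) auto
qed simp

lemma pcas_hd_last:
  assumes "pcas u c v" "c \<noteq> []"
  shows "fst (hd c) = u" "snd (last c) = v"
  using assms by (induction c arbitrary: u) (auto split: if_splits)

lemma pcas_tl_pawalk_verts: "pcas u c v \<Longrightarrow> tl (pawalk_verts u c) = map snd c"
proof (induction c arbitrary: u)
  case (Cons e c)
  then show ?case by (cases c) auto
qed simp

text \<open>The two neighbours of the largest vertex of a cycle would both be its parent.\<close>
lemma parent_graph_acyclic:
  assumes p: "\<And>v. 0 < v \<Longrightarrow> p v < v"
    and cyc: "pre_digraph.cycle (with_proj (parent_graph V p)) c"
  shows "length c < 3"
proof (rule ccontr)
  assume "\<not> length c < 3"
  define k where "k = length c"
  have k: "3 \<le> k" using \<open>\<not> length c < 3\<close> by (simp add: k_def)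
  obtain u where arcs: "set c \<subseteq> parcs (parent_graph V p)" and cas: "pcas u c u"
    and dist: "distinct (tl (pawalk_verts u c))" and ne: "c \<noteq> []"
    using cyc
    unfolding pre_digraph.cycle_def pre_digraph.awalk_def cas_with_proj_eq awalk_verts_with_proj_eq
    by auto
  have dist: "distinct (map snd c)" using dist pcas_tl_pawalk_verts[OF cas] by simp
  have nxt: "fst (c ! (Suc i mod k)) = snd (c ! i)" if "i < k" for i
  proof (cases "Suc i = k")
    case True
    then have "length c - Suc 0 = i" by (simp add: k_def)
    then show ?thesis using pcas_hd_last[OF cas ne] ne True
      by (simp add: last_conv_nth hd_conv_nth)
  next
    case False
    then show ?thesis using that pcas_nth[OF cas, of i] by (simp add: k_def)
  qed
  have bound: "\<forall>j. j < k \<longrightarrow> snd (c ! j) < Suc (Max (snd ` set c))"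
    by (simp add: k_def less_Suc_eq_le)
  have "0 < k" using k by simp
  from ex_has_greatest_nat[of "\<lambda>j. j < k", OF this bound]
  obtain i where i: "i < k" and max: "\<And>j. j < k \<Longrightarrow> snd (c ! j) \<le> snd (c ! i)"
    by blast
  define i1 where "i1 = Suc i mod k"
  \<comment> \<open>Adding \<open>k\<close> before subtracting \<open>1\<close> keeps natural
    subtraction from truncating at \<open>i = 0\<close>.\<close>
  define i0 where "i0 = (i + k - 1) mod k"
  have lt: "i1 < k" "i0 < k" using k by (auto simp: i1_def i0_def)
  have "Suc i0 mod k = i"
    using i k by (simp add: i0_def mod_Suc_eq)
  then have i0: "fst (c ! i) = snd (c ! i0)" using nxt[OF lt(2)] by simp
  have arc: "(fst (c ! j), snd (c ! j)) \<in> parcs (parent_graph V p)" if "j < k" for j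
    using arcs that by (auto simp: k_def)
  have parent: "b = p a" if "(a, b) \<in> parcs (parent_graph V p)" "b \<le> a" for a b
    using that p[of b] by (auto simp: parcs_parent_graph)
  have "snd (c ! i1) = p (snd (c ! i))"
    using arc[OF lt(1)] nxt[OF i] max[OF lt(1)] parent by (simp add: i1_def)
  moreover have "snd (c ! i0) = p (snd (c ! i))"
  proof -
    have "(snd (c ! i), snd (c ! i0)) \<in> parcs (parent_graph V p)"
      using arc[OF i] i0 by (auto simp: parcs_parent_graph)
    then show ?thesis using max[OF lt(2)] parent by blast
  qed
  ultimately have "i0 = i1"
    using dist lt by (simp add: distinct_conv_nth k_def) metis
  \<comment> \<open>Here \<open>3 \<le> k\<close> is essential: for \<open>k = 2\<close> the cyclic
    predecessor and successor of an index coincide.\<close>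
  moreover have "i0 \<noteq> i1"
  proof -
    consider "i = 0" | "0 < i" "Suc i = k" | "0 < i" "Suc i < k" using i by linarith
    then show ?thesis
    proof cases
      case 1
      then have "i0 = k - 1" "i1 = 1" using k by (simp_all add: i0_def i1_def)
      then show ?thesis using k by linarith
    next
      case 2
      have "i + k - 1 = k + (i - 1)" using 2(1) by linarith
      then have "i0 = (k + (i - 1)) mod k" by (simp only: i0_def)
      then have "i0 = i - 1" using i by (simp only: mod_add_self1) simp
      moreover have "i1 = 0" using 2(2) by (simp add: i1_def)
      ultimately show ?thesis using k 2(2) by linarith
    next
      case 3
      have "i + k - 1 = k + (i - 1)" using 3(1) by linarith
      then have "i0 = (k + (i - 1)) mod k" by (simp only: i0_def)
      then have "i0 = i - 1" using i by (simp only: mod_add_self1) simp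
      moreover have "i1 = Suc i" using 3(2) by (simp add: i1_def)
      ultimately show ?thesis by linarith
    qed
  qed
  ultimately show False by simp
qed

lemma is_tree_parent_graph:
  assumes "0 < n" "\<And>v. 0 < v \<Longrightarrow> p v < v"
  shows "is_tree (parent_graph {..<n} p)"
proof -
  have "Digraph_Component.connected (with_proj (parent_graph {..<n} p))"
    using assms by (intro connected_parent_graph) (auto intro: less_trans)
  moreover have "pair_graph (parent_graph {..<n} p)"
    using assms(2) by (intro pair_graph_parent_graph) simp_all
  ultimately show ?thesis
    unfolding is_tree_def using parent_graph_acyclic[of p "{..<n}", OF assms(2)] by fastforce
qed

text \<open>An induced subgraph is determined by its vertex set, so counting subtrees becomes
  counting connected vertex sets.\<close>

lemma subtrees_parent_graph:
  "subtrees (parent_graph U p) =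
    (\<lambda>V. parent_graph V p) ` {V. V \<subseteq> U \<and> Digraph_Component.connected (with_proj (parent_graph V p))}"
proof -
  have ind: "induced_subgraph (with_proj S) (with_proj (parent_graph U p)) \<longleftrightarrow>
     pverts S \<subseteq> U \<and> S = parent_graph (pverts S) p" for S
  proof
    assume *: "induced_subgraph (with_proj S) (with_proj (parent_graph U p))"
    then have sub: "pverts S \<subseteq> U" by (auto simp: induced_subgraph_def subgraph_def)
    have "parcs S = {e \<in> parcs (parent_graph U p). fst e \<in> pverts S \<and> snd e \<in> pverts S}"
      using * by (auto simp: induced_subgraph_def)
    then have "parcs S = parcs (parent_graph (pverts S) p)"
      using sub by (auto simp: parcs_parent_graph)
    then show "pverts S \<subseteq> U \<and> S = parent_graph (pverts S) p"
      using sub by (simp add: pair_pre_digraph.equality)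
  next
    assume *: "pverts S \<subseteq> U \<and> S = parent_graph (pverts S) p"
    obtain V where "V \<subseteq> U" "S = parent_graph V p" using * by blast
    then show "induced_subgraph (with_proj S) (with_proj (parent_graph U p))"
      using wf_digraph_parent_graph[of V p] wf_digraph_parent_graph[of U p]
      by (auto simp: induced_subgraph_def subgraph_def parcs_parent_graph)
  qed
  show ?thesis
    unfolding subtrees_def ind by auto
qed

section \<open>Subtrees of caterpillars\<close>

text \<open>The spine is the path on \<open>{..<M}\<close>. If \<open>h\<close> takes values below
  \<open>M\<close>, every vertex from \<open>M\<close> on is a leaf attached to the spine; numbering
  leaves last makes parents smaller than their children.\<close>

definition caterpillar_parent :: "nat \<Rightarrow> (nat \<Rightarrow> nat) \<Rightarrow> nat \<Rightarrow> nat" where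
  "caterpillar_parent M h v = (if v < M then v - 1 else h v)"

text \<open>The leaves available to a subtree whose spine part is \<open>{a..b}\<close>.\<close>

definition leaves_over :: "nat \<Rightarrow> nat \<Rightarrow> (nat \<Rightarrow> nat) \<Rightarrow> nat \<Rightarrow> nat \<Rightarrow> nat set" where
  "leaves_over n M h a b = {v \<in> {M..<n}. h v \<in> {a..b}}"

lemma finite_leaves_over [simp]: "finite (leaves_over n M h a b)"
  by (simp add: leaves_over_def)

lemma caterpillar_parent_less:
  assumes "\<And>v. M \<le> v \<Longrightarrow> h v < M" "0 < v"
  shows "caterpillar_parent M h v < v"
  using assms(1)[of v] assms(2) by (auto simp: caterpillar_parent_def)

lemma caterpillar_edge:
  assumes h: "\<And>v. M \<le> v \<Longrightarrow> h v < M"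
    and "(u, v) \<in> parcs (parent_graph V (caterpillar_parent M h))"
  shows "u < M \<and> v < M \<and> (u = Suc v \<or> v = Suc u) \<or> M \<le> u \<and> v = h u \<or> M \<le> v \<and> u = h v"
  using assms(2) by (auto simp: parcs_parent_graph caterpillar_parent_def split: if_splits)

text \<open>A leaf in a subtree with a second vertex brings its only neighbour along, so a subtree
  off the spine is a single leaf. Otherwise the spine part has no gap, because a missing spine
  vertex would separate its two sides.\<close>

lemma caterpillar_subtree_verts:
  assumes h: "\<And>v. M \<le> v \<Longrightarrow> h v < M"
    and V: "V \<subseteq> {..<n}"
    and con: "Digraph_Component.connected (with_proj (parent_graph V (caterpillar_parent M h)))"
  shows "(\<exists>l \<in> {M..<n}. V = {l}) \<or>
    (\<exists>a b A. a \<le> b \<and> b < M \<and> A \<subseteq> leaves_over n M h a b \<and> V = {a..b} \<union> A)"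
proof -
  let ?G = "parent_graph V (caterpillar_parent M h)"
  have ne: "V \<noteq> {}"
    using con by (auto simp: Digraph_Component.connected_def strongly_connected_def)
  have fin: "finite V" using V finite_subset by blast
  have leaf: "h l \<in> V" if l: "l \<in> V" "M \<le> l" and y: "y \<in> V" "y \<noteq> l" for l y
  proof -
    have "{l} \<subseteq> pverts ?G" "l \<in> {l}" "y \<in> pverts ?G - {l}" using l y by auto
    from connected_cut[OF con this] obtain v where
      "v \<in> V" "(l, v) \<in> parcs ?G \<or> (v, l) \<in> parcs ?G" by auto
    then show ?thesis
      using caterpillar_edge[of M h l v V, OF h] caterpillar_edge[of M h v l V, OF h] l(2) h[of l] h[of v]
      by (metis not_le)
  qed
  show ?thesis
  proof (cases "V \<inter> {..<M} = {}")
    case True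
    obtain l where l: "l \<in> V" using ne by auto
    then have "M \<le> l" "l < n" using True V by force+
    moreover have "V = {l}"
    proof (rule ccontr)
      assume "V \<noteq> {l}"
      then obtain y where "y \<in> V" "y \<noteq> l" using l by auto
      from leaf[OF l \<open>M \<le> l\<close> this] h[OF \<open>M \<le> l\<close>] True show False by auto
    qed
    ultimately show ?thesis by auto
  next
    case False
    define a b where "a = Min (V \<inter> {..<M})" and "b = Max (V \<inter> {..<M})"
    have a: "a \<in> V" "a < M" and b: "b \<in> V" "b < M"
      using Min_in[of "V \<inter> {..<M}"] Max_in[of "V \<inter> {..<M}"] fin False by (auto simp: a_def b_def)
    have ab: "a \<le> v \<and> v \<le> b" if "v \<in> V" "v < M" for v
      using that fin by (auto simp: a_def b_def intro: Min_le Max_ge)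
    have interval: "c \<in> V" if c: "c \<in> {a..b}" for c
    proof (rule ccontr)
      assume nc: "c \<notin> V"
      define s where "s v = (if v < M then v else h v)" for v
      define X where "X = {v \<in> V. s v < c}"
      have "a \<noteq> c" using a nc by auto
      then have "X \<subseteq> pverts ?G" "a \<in> X" "b \<in> pverts ?G - X"
        using a b c by (auto simp: X_def s_def)
      then obtain u v where "u \<in> X" "v \<in> pverts ?G - X"
        and edge: "(u, v) \<in> parcs ?G \<or> (v, u) \<in> parcs ?G" by (rule connected_cut[OF con])
      then have uv: "u \<in> X" "v \<in> V" "v \<notin> X" by simp_all
      have "u < M \<and> v < M \<and> (u = Suc v \<or> v = Suc u) \<or> M \<le> u \<and> v = h u \<or> M \<le> v \<and> u = h v"
        using edge caterpillar_edge[of M h u v V, OF h] caterpillar_edge[of M h v u V, OF h] by blast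
      moreover have "u \<in> V" "s u < c" "c \<le> s v" using uv by (auto simp: X_def)
      \<comment> \<open>Leaf edges preserve \<open>s\<close> and spine edges change it by one, so an
        edge leaving \<open>X\<close> can only run from \<open>c - 1\<close> to
        \<open>c\<close>.\<close>
      ultimately have "v = c"
        using h[of u] h[of v] by (auto simp: s_def split: if_splits)
      then show False using nc uv(2) by simp
    qed
    have lv: "v \<in> leaves_over n M h a b" if v: "v \<in> V" "M \<le> v" for v
    proof -
      have "h v \<in> V" using leaf[OF v a(1)] a(2) v(2) by simp
      then show ?thesis using ab[of "h v"] h[OF v(2)] v V by (auto simp: leaves_over_def)
    qed
    define A where "A = V - {..<M}"
    have "A \<subseteq> leaves_over n M h a b"
      by (rule subsetI, rule lv) (simp_all add: A_def)
    moreover have "V = {a..b} \<union> A"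
    proof (intro set_eqI iffI)
      show "v \<in> {a..b} \<union> A" if "v \<in> V" for v using that ab[of v] by (simp add: A_def) linarith
      show "v \<in> V" if "v \<in> {a..b} \<union> A" for v using that interval[of v] by (auto simp: A_def)
    qed
    moreover have "a \<le> b" using ab[OF a] by simp
    ultimately show ?thesis using b(2) by blast
  qed
qed

text \<open>Supplies the subtrees containing the whole spine: such a vertex set is closed under
  parents.\<close>

lemma caterpillar_spine_connected:
  assumes h: "\<And>v. M \<le> v \<Longrightarrow> h v < M" and "0 < M"
  shows "Digraph_Component.connected (with_proj (parent_graph ({..<M} \<union> A) (caterpillar_parent M h)))"
proof (rule connected_parent_graph)
  show "caterpillar_parent M h v < v" if "0 < v" for v
    using caterpillar_parent_less[OF h that] .
  show "0 \<in> {..<M} \<union> A" using assms(2) by simp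
  show "caterpillar_parent M h v \<in> {..<M} \<union> A" for v
    using assms(2) h[of v] by (auto simp: caterpillar_parent_def)
qed

section \<open>Bounding the mean through the number of missing vertices\<close>

lemma sum_Un_le_real:
  fixes g :: "'a \<Rightarrow> real"
  assumes "finite A" "finite B" "\<And>x. 0 \<le> g x"
  shows "sum g (A \<union> B) \<le> sum g A + sum g B"
  using sum.union_inter[OF assms(1,2), of g] sum_nonneg[of "A \<inter> B" g] assms(3) by simp

text \<open>Complementation identifies this sum with the sum of \<open>card A\<close>, and the two
  add up to \<open>card L\<close> for each of the \<open>2 ^ card L\<close> subsets.\<close>

lemma sum_card_diff_Pow:
  assumes "finite L"
  shows "(\<Sum>A\<in>Pow L. real (card L - card A)) = real (card L) * 2 ^ card L / 2"
proof -
  have "(\<Sum>A\<in>Pow L. real (card L - card A)) = (\<Sum>A\<in>Pow L. real (card A))"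
  proof (rule sum.reindex_bij_witness[of _ "\<lambda>A. L - A" "\<lambda>A. L - A"])
    fix A assume "A \<in> Pow L"
    then have "A \<subseteq> L" by simp
    then show "real (card (L - A)) = real (card L - card A)"
      using assms by (simp add: card_Diff_subset finite_subset)
  qed auto
  moreover have "(\<Sum>A\<in>Pow L. real (card L - card A)) + (\<Sum>A\<in>Pow L. real (card A)) =
    (\<Sum>A\<in>Pow L. real (card L))"
    unfolding sum.distrib[symmetric]
    by (rule sum.cong) (use assms in \<open>auto simp: of_nat_diff card_mono\<close>)
  ultimately show ?thesis using assms by (simp add: card_Pow mult_ac)
qed

definition proper_intervals :: "nat \<Rightarrow> (nat \<times> nat) set" where
  "proper_intervals M = {(a, b). a \<le> b \<and> b < M} - {(0, M - 1)}"

lemma finite_proper_intervals [simp]: "finite (proper_intervals M)"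
  by (rule finite_subset[of _ "{..<M} \<times> {..<M}"]) (auto simp: proper_intervals_def)

text \<open>The mean is \<open>n\<close> minus the average number of missing vertices. The total
  missing is bounded above over a covering family, and the number of subtrees below by the
  \<open>2 ^ K\<close> that contain the spine. Those miss \<open>K / 2\<close> vertices on average;
  the final quotient accounts for single leaves and for incomplete spines.\<close>

lemma mean_subtree_order_caterpillar_ge:
  assumes h: "\<And>v. M \<le> v \<Longrightarrow> h v < M" and M: "0 < M" and K: "n = M + K"
  shows "mean_subtree_order (parent_graph {..<n} (caterpillar_parent M h)) \<ge>
    real n - real K / 2 -
    (real K * real n + (\<Sum>(a, b)\<in>proper_intervals M.
        2 ^ card (leaves_over n M h a b) * real (n - (Suc b - a)))) / 2 ^ K"
proof -
  let ?p = "caterpillar_parent M h"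
  let ?I = "proper_intervals M"
  let ?L = "leaves_over n M h"
  define \<V> where
    "\<V> = {V. V \<subseteq> {..<n} \<and> Digraph_Component.connected (with_proj (parent_graph V ?p))}"
  have sub: "subtrees (parent_graph {..<n} ?p) = (\<lambda>V. parent_graph V ?p) ` \<V>"
    unfolding \<V>_def by (rule subtrees_parent_graph)
  have inj: "inj_on (\<lambda>V. parent_graph V ?p) \<V>"
    by (rule inj_onI) (metis pverts_parent_graph)
  have fin: "finite \<V>" by (rule finite_subset[of _ "Pow {..<n}"]) (auto simp: \<V>_def)
  have mean: "mean_subtree_order (parent_graph {..<n} ?p) = (\<Sum>V\<in>\<V>. real (card V)) / card \<V>"
    unfolding mean_subtree_order_def sub by (simp add: sum.reindex[OF inj] card_image[OF inj])
  have disj: "{..<M} \<inter> A = {}" if "A \<subseteq> {M..<n}" for A using that by auto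
  have card_ge: "2 ^ K \<le> card \<V>"
  proof -
    have "inj_on (\<lambda>A. {..<M} \<union> A) (Pow {M..<n})"
      by (rule inj_on_inverseI[of _ "\<lambda>V. V - {..<M}"]) auto
    then have "card ((\<lambda>A. {..<M} \<union> A) ` Pow {M..<n}) = 2 ^ K"
      using K by (simp add: card_image card_Pow)
    moreover have "(\<lambda>A. {..<M} \<union> A) ` Pow {M..<n} \<subseteq> \<V>"
      using caterpillar_spine_connected[OF h M] K by (auto simp: \<V>_def)
    ultimately show ?thesis using card_mono[OF fin] by metis
  qed
  define g where "g V = real (n - card V)" for V :: "nat set"
  have g0: "0 \<le> g V" for V by (simp add: g_def)
  \<comment> \<open>The cover: single leaves (\<open>S1\<close>), full spine (\<open>S2\<close>),
    incomplete spine (\<open>S3\<close>). Since \<open>g\<close> is nonnegative, an inclusion is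
    enough.\<close>
  define S1 where "S1 = (\<lambda>l. {l}) ` {M..<n}"
  define S2 where "S2 = (\<lambda>A. {..<M} \<union> A) ` Pow {M..<n}"
  define S3 where "S3 = (\<lambda>((a, b), A). {a..b} \<union> A) ` (SIGMA ab:?I. Pow (?L (fst ab) (snd ab)))"
  have finS: "finite S1" "finite S2" "finite S3"
    unfolding S1_def S2_def S3_def by (simp, simp, intro finite_imageI finite_SigmaI) simp_all
  have cover: "\<V> \<subseteq> S1 \<union> S2 \<union> S3"
  proof
    fix V assume "V \<in> \<V>"
    then have "(\<exists>l \<in> {M..<n}. V = {l}) \<or>
      (\<exists>a b A. a \<le> b \<and> b < M \<and> A \<subseteq> ?L a b \<and> V = {a..b} \<union> A)"
      by (intro caterpillar_subtree_verts h) (simp_all add: \<V>_def)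
    then show "V \<in> S1 \<union> S2 \<union> S3"
    proof (elim disjE bexE exE conjE)
      fix l assume "l \<in> {M..<n}" "V = {l}"
      then show ?thesis by (simp add: S1_def)
    next
      fix a b A assume *: "a \<le> b" "b < M" "A \<subseteq> ?L a b" "V = {a..b} \<union> A"
      show ?thesis
      proof (cases "(a, b) = (0, M - 1)")
        case True
        then have "{a..b} = {..<M}" using M by auto
        moreover have "A \<subseteq> {M..<n}" using *(3) by (auto simp: leaves_over_def)
        ultimately have "V \<in> S2" using *(4) by (simp add: S2_def)
        then show ?thesis by simp
      next
        case False
        then have "((a, b), A) \<in> (SIGMA ab:?I. Pow (?L (fst ab) (snd ab)))"
          using * by (auto simp: proper_intervals_def)
        then have "V \<in> S3" unfolding S3_def by (rule rev_image_eqI) (simp add: *(4))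
        then show ?thesis by simp
      qed
    qed
  qed
  have 1: "sum g S1 \<le> real K * real n"
  proof -
    have "sum g S1 \<le> sum (g \<circ> (\<lambda>l. {l})) {M..<n}"
      unfolding S1_def by (rule sum_image_le) (auto simp: g0)
    also have "\<dots> \<le> (\<Sum>l\<in>{M..<n}. real n)" by (rule sum_mono) (simp add: g_def)
    finally show ?thesis using K by simp
  qed
  have 2: "sum g S2 \<le> real K * 2 ^ K / 2"
  proof -
    have "sum g S2 \<le> sum (g \<circ> (\<lambda>A. {..<M} \<union> A)) (Pow {M..<n})"
      unfolding S2_def by (rule sum_image_le) (auto simp: g0)
    also have "\<dots> = (\<Sum>A\<in>Pow {M..<n}. real (card {M..<n} - card A))"
    proof (rule sum.cong)
      fix A assume "A \<in> Pow {M..<n}"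
      then have A: "A \<subseteq> {M..<n}" by simp
      then have "card ({..<M} \<union> A) = M + card A"
        using disj[OF A] finite_subset[OF A] by (subst card_Un_disjoint) auto
      then show "(g \<circ> (\<lambda>A. {..<M} \<union> A)) A = real (card {M..<n} - card A)"
        by (simp add: g_def)
    qed simp
    also have "\<dots> = real K * 2 ^ K / 2" using K by (subst sum_card_diff_Pow) auto
    finally show ?thesis .
  qed
  \<comment> \<open>The leaves in \<open>A\<close> are counted as missing too, so all leaf sets over
    one interval get the same bound.\<close>
  have 3: "sum g S3 \<le> (\<Sum>(a, b)\<in>?I. 2 ^ card (?L a b) * real (n - (Suc b - a)))"
  proof -
    have "sum g S3 \<le> sum (g \<circ> (\<lambda>((a, b), A). {a..b} \<union> A)) (SIGMA ab:?I. Pow (?L (fst ab) (snd ab)))"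
      unfolding S3_def by (rule sum_image_le) (intro finite_SigmaI, simp_all add: g0)
    also have "\<dots> = (\<Sum>ab\<in>?I. \<Sum>A\<in>Pow (?L (fst ab) (snd ab)). g ({fst ab..snd ab} \<union> A))"
      by (subst sum.Sigma) (auto simp: case_prod_beta)
    also have "\<dots> \<le> (\<Sum>ab\<in>?I. \<Sum>A\<in>Pow (?L (fst ab) (snd ab)). real (n - (Suc (snd ab) - fst ab)))"
    proof (intro sum_mono)
      fix ab A assume "A \<in> Pow (?L (fst ab) (snd ab))"
      then have "finite A" by (auto intro: finite_subset[OF _ finite_leaves_over])
      then have "card {fst ab..snd ab} \<le> card ({fst ab..snd ab} \<union> A)" by (intro card_mono) auto
      then show "g ({fst ab..snd ab} \<union> A) \<le> real (n - (Suc (snd ab) - fst ab))"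
        by (simp add: g_def)
    qed
    also have "\<dots> = (\<Sum>(a, b)\<in>?I. 2 ^ card (?L a b) * real (n - (Suc b - a)))"
      by (simp add: card_Pow case_prod_beta)
    finally show ?thesis .
  qed
  have "sum g \<V> \<le> sum g (S1 \<union> S2 \<union> S3)"
    using finS cover g0 by (intro sum_mono2) auto
  also have "\<dots> \<le> sum g S1 + sum g S2 + sum g S3"
    using sum_Un_le_real[of "S1 \<union> S2" S3 g] sum_Un_le_real[of S1 S2 g] finS g0 by force
  finally have D: "sum g \<V> \<le> real K * 2 ^ K / 2 + (real K * real n +
      (\<Sum>(a, b)\<in>?I. 2 ^ card (?L a b) * real (n - (Suc b - a))))"
    using 1 2 3 by linarith
  have pos: "0 < real (card \<V>)" and N: "2 ^ K \<le> real (card \<V>)"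
  proof -
    show "2 ^ K \<le> real (card \<V>)" using of_nat_mono[OF card_ge, where ?'a = real] by simp
    then show "0 < real (card \<V>)" by (rule less_le_trans[rotated]) simp
  qed
  have "(\<Sum>V\<in>\<V>. real (card V)) = (\<Sum>V\<in>\<V>. real n - g V)"
  proof (rule sum.cong)
    fix V assume "V \<in> \<V>"
    then have "card V \<le> n" using card_mono[of "{..<n}" V] by (auto simp: \<V>_def)
    then show "real (card V) = real n - g V" by (simp add: g_def of_nat_diff)
  qed simp
  then have "mean_subtree_order (parent_graph {..<n} ?p) = real n - sum g \<V> / card \<V>"
    unfolding mean using pos by (simp add: sum_subtractf field_simps)
  \<comment> \<open>Replacing the number of subtrees by the smaller \<open>2 ^ K\<close> only
    increases the quotient of a nonnegative sum.\<close>
  moreover have "sum g \<V> / card \<V> \<le> sum g \<V> / 2 ^ K"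
    using N g0 by (intro divide_left_mono sum_nonneg mult_pos_pos pos) auto
  moreover have "sum g \<V> / 2 ^ K \<le> (real K * 2 ^ K / 2 + (real K * real n +
      (\<Sum>(a, b)\<in>?I. 2 ^ card (?L a b) * real (n - (Suc b - a))))) / 2 ^ K"
    using D by (intro divide_right_mono) auto
  ultimately show ?thesis by (simp add: add_divide_distrib)
qed

section \<open>A caterpillar with most leaves at its ends\<close>

text \<open>
  \<open>2\<^sup>y\<close> times this weight bounds the number of leaf sets available to a subtree from which \<open>d\<close> spine
  vertices are cut off at one end only. The offset \<open>8\<close> absorbs the remainder modulo \<open>9\<close> of the
  spine length, so that one function serves both ends.
\<close>
definition end_weight :: "nat \<Rightarrow> nat \<Rightarrow> real" where
  "end_weight q d = 1 + of_bool (d \<le> 8 * q + 8) + 2 * of_bool (d \<le> 6 * q + 8) +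
     4 * of_bool (d \<le> 3 * q + 8) + 8 * of_bool (d \<le> q + 8)"

lemma end_weight_le: "end_weight q d \<le> 16"
  by (simp add: end_weight_def)

text \<open>The indicator truncates a Gauss sum at \<open>m\<close>; leaving \<open>m'\<close> free
  lets every threshold of \<open>end_weight\<close> share one summation range.\<close>

lemma sum_of_bool_le:
  assumes "m \<le> c * q + 8"
  shows "(\<Sum>d=1..m'. real d * of_bool (d \<le> m)) \<le> (real c * real q + 9)\<^sup>2 / 2"
proof -
  have "(\<Sum>d=1..m'. real d * of_bool (d \<le> m)) = (\<Sum>d\<in>{1..m'} \<inter> {..m}. real d)"
    by (intro sum.mono_neutral_cong_right) auto
  also have "\<dots> \<le> (\<Sum>d\<in>{0..m}. real d)" by (intro sum_mono2) auto
  also have "\<dots> = real m * (real m + 1) / 2"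
    using double_gauss_sum[of m, where ?'a = real] by simp
  also have "\<dots> \<le> (real c * real q + 9)\<^sup>2 / 2"
  proof -
    have "real m \<le> real c * real q + 8"
      using of_nat_mono[OF assms, where ?'a = real] by simp
    then have "(real m + 1)\<^sup>2 \<le> (real c * real q + 9)\<^sup>2" by (intro power_mono) auto
    moreover have "real m * (real m + 1) \<le> (real m + 1)\<^sup>2" by (simp add: power2_eq_square)
    ultimately show ?thesis by linarith
  qed
  finally show ?thesis .
qed

text \<open>Each indicator contributes its coefficient times half the square of its threshold:
  \<open>81 + 64 + 2 * 36 + 4 * 9 + 8 * 1 = 261\<close>. The shift \<open>k\<close>, later the
  number of leaves, is charged at the maximal weight \<open>16\<close>.\<close>

lemma sum_end_weight_le:
  assumes "m \<le> 9 * q + 8"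
  shows "(\<Sum>d=1..m. (real d + k) * end_weight q d) \<le>
    (261 * (real q)\<^sup>2 + 882 * real q + 1296) / 2 + 16 * real m * real k"
proof -
  \<comment> \<open>The indicator of \<open>d \<le> m\<close> is \<open>1\<close> on the range; it
    brings the constant summand of \<open>end_weight\<close> into the form of
    \<open>sum_of_bool_le\<close>.\<close>
  have split: "(real d + real k) * end_weight q d \<le>
     real d * of_bool (d \<le> m) + real d * of_bool (d \<le> 8 * q + 8)
     + 2 * (real d * of_bool (d \<le> 6 * q + 8)) + 4 * (real d * of_bool (d \<le> 3 * q + 8))
     + 8 * (real d * of_bool (d \<le> 1 * q + 8)) + 16 * real k" if "d \<in> {1..m}" for d
  proof -
    have "real k * end_weight q d \<le> real k * 16"
      by (intro mult_left_mono end_weight_le) simp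
    then show ?thesis using that by (simp add: end_weight_def algebra_simps)
  qed
  have "(\<Sum>d=1..m. (real d + k) * end_weight q d) \<le>
     (\<Sum>d=1..m. real d * of_bool (d \<le> m) + real d * of_bool (d \<le> 8 * q + 8)
     + 2 * (real d * of_bool (d \<le> 6 * q + 8)) + 4 * (real d * of_bool (d \<le> 3 * q + 8))
     + 8 * (real d * of_bool (d \<le> 1 * q + 8)) + 16 * real k)"
    by (rule sum_mono) (rule split)
  also have "\<dots> =
     (\<Sum>d=1..m. real d * of_bool (d \<le> m)) + (\<Sum>d=1..m. real d * of_bool (d \<le> 8 * q + 8))
     + 2 * (\<Sum>d=1..m. real d * of_bool (d \<le> 6 * q + 8))
     + 4 * (\<Sum>d=1..m. real d * of_bool (d \<le> 3 * q + 8))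
     + 8 * (\<Sum>d=1..m. real d * of_bool (d \<le> 1 * q + 8)) + 16 * real m * real k"
    unfolding sum.distrib sum_distrib_left by simp
  also have "\<dots> \<le> (real 9 * real q + 9)\<^sup>2 / 2 + (real 8 * real q + 9)\<^sup>2 / 2
     + 2 * ((real 6 * real q + 9)\<^sup>2 / 2) + 4 * ((real 3 * real q + 9)\<^sup>2 / 2)
     + 8 * ((real 1 * real q + 9)\<^sup>2 / 2) + 16 * real m * real k"
    by (intro add_mono mult_left_mono sum_of_bool_le) (use assms in auto)
  also have "\<dots> = (261 * (real q)\<^sup>2 + 882 * real q + 1296) / 2 + 16 * real m * real k"
    by (simp add: power2_eq_square field_simps)
  finally show ?thesis .
qed

section \<open>Leaf placement and the leaves that survive a cut\<close>

definition leaf_position :: "nat \<Rightarrow> nat \<Rightarrow> nat \<Rightarrow> nat \<Rightarrow> nat" where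
  "leaf_position M q y v = (if v = M then q else if v = M + 1 then 3 * q else if v = M + 2 then 6 * q
     else if v = M + 3 then 8 * q else if v < M + 4 + y then 0 else M - 1)"

text \<open>The two intervals hold surviving inner leaves and leaves at an uncut end;
  \<open>w\<close> is the factor due to \<open>k\<close> inner leaves.\<close>

lemma power_card_le:
  assumes "A \<subseteq> {a..<b} \<union> {c..<d}" "(b - a) + (d - c) \<le> k + y" "2 ^ k = w"
  shows "(2::real) ^ card A \<le> 2 ^ y * w"
proof -
  have "card A \<le> card ({a..<b} \<union> {c..<d})" by (intro card_mono assms) auto
  also have "\<dots> \<le> card {a..<b} + card {c..<d}" by (rule card_Un_le)
  finally have "card A \<le> k + y" using assms(2) by simp
  then have "(2::real) ^ card A \<le> 2 ^ (k + y)" by (intro power_increasing) auto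
  then show ?thesis using assms(3) by (simp add: power_add mult.commute)
qed

text \<open>The coefficients \<open>1, 1, 2, 4, 8\<close> accumulate to powers of two, one for each
  possible number of surviving inner leaves.\<close>

lemma end_weight_cases:
  obtains "d \<le> q + 8" "end_weight q d = 16"
  | "q + 8 < d" "d \<le> 3 * q + 8" "end_weight q d = 8"
  | "3 * q + 8 < d" "d \<le> 6 * q + 8" "end_weight q d = 4"
  | "6 * q + 8 < d" "d \<le> 8 * q + 8" "end_weight q d = 2"
  | "8 * q + 8 < d" "end_weight q d = 1"
proof -
  consider "d \<le> q + 8" | "q + 8 < d" "d \<le> 3 * q + 8" | "3 * q + 8 < d" "d \<le> 6 * q + 8"
    | "6 * q + 8 < d" "d \<le> 8 * q + 8" | "8 * q + 8 < d" by linarith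
  then show ?thesis by cases (simp_all add: end_weight_def that)
qed

lemma leaves_over_cases:
  assumes "v \<in> leaves_over n M (leaf_position M q y) a b"
  obtains "v = M" "a \<le> q" "q \<le> b"
  | "v = M + 1" "a \<le> 3 * q" "3 * q \<le> b"
  | "v = M + 2" "a \<le> 6 * q" "6 * q \<le> b"
  | "v = M + 3" "a \<le> 8 * q" "8 * q \<le> b"
  | "M + 4 \<le> v" "v < M + 4 + y" "a = 0"
  | "M + 4 + y \<le> v" "v < n" "M - 1 \<le> b"
proof -
  have v: "M \<le> v" "v < n" "a \<le> leaf_position M q y v" "leaf_position M q y v \<le> b"
    using assms by (simp_all add: leaves_over_def)
  consider "v = M" | "v = M + 1" | "v = M + 2" | "v = M + 3"
    | "M + 4 \<le> v" "v < M + 4 + y" | "M + 4 + y \<le> v" using v(1) by linarith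
  then show ?thesis by cases (use v in \<open>simp_all add: leaf_position_def that\<close>)
qed

text \<open>Any cut on the left removes the \<open>y\<close> leaves at \<open>0\<close>, and an
  inner leaf is lost once \<open>d\<close> exceeds its position. The later thresholds in
  \<open>end_weight\<close> only overestimate what survives.\<close>

lemma left_cut_weight:
  assumes n: "n = M + 4 + 2 * y" and d: "1 \<le> d"
  shows "2 ^ card (leaves_over n M (leaf_position M q y) d (M - 1)) \<le> 2 ^ y * end_weight q d"
proof -
  \<comment> \<open>Here \<open>c\<close> counts inner leaves known to be lost.\<close>
  have sub: "leaves_over n M (leaf_position M q y) d (M - 1) \<subseteq> {M + c..<M + 4} \<union> {M + 4 + y..<n}"
    if "1 \<le> c \<longrightarrow> q < d" "2 \<le> c \<longrightarrow> 3 * q < d" "3 \<le> c \<longrightarrow> 6 * q < d" "4 \<le> c \<longrightarrow> 8 * q < d" for c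
  proof
    fix v assume "v \<in> leaves_over n M (leaf_position M q y) d (M - 1)"
    then show "v \<in> {M + c..<M + 4} \<union> {M + 4 + y..<n}"
      unfolding Un_iff atLeastLessThan_iff
      by (cases rule: leaves_over_cases) (use that d in presburger)+
  qed
  show ?thesis
  proof (cases rule: end_weight_cases[of d q])
    case 1
    show ?thesis unfolding 1(2) by (rule power_card_le[OF sub[of 0], of 4]) (use n in simp_all)
  next
    case 2
    then show ?thesis unfolding 2(3) by (intro power_card_le[OF sub[of 1], of 3]) (use n in simp_all)
  next
    case 3
    then show ?thesis unfolding 3(3) by (intro power_card_le[OF sub[of 2], of 2]) (use n in simp_all)
  next
    case 4
    then show ?thesis unfolding 4(3) by (intro power_card_le[OF sub[of 3], of 1]) (use n in simp_all)
  next
    case 5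
    then show ?thesis unfolding 5(2) by (intro power_card_le[OF sub[of 4], of 0]) (use n in simp_all)
  qed
qed

text \<open>The mirror image, where the remainder matters: a leaf at \<open>8 * q\<close> survives
  only if \<open>d \<le> q + r\<close>, and \<open>r < 9\<close> gives the threshold
  \<open>q + 8\<close>; the other three are analogous.\<close>

lemma right_cut_weight:
  assumes M: "M = 9 * q + r + 1" "r < 9" and d: "1 \<le> d" "d < M"
  shows "2 ^ card (leaves_over n M (leaf_position M q y) 0 (M - 1 - d)) \<le> 2 ^ y * end_weight q d"
proof -
  \<comment> \<open>Here \<open>c\<close> counts inner leaves that may survive; they are lost from
    the largest position down.\<close>
  have sub: "leaves_over n M (leaf_position M q y) 0 (M - 1 - d) \<subseteq> {M..<M + c} \<union> {M + 4..<M + 4 + y}"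
    if c: "d \<le> 8 * q + 8 \<Longrightarrow> 1 \<le> c" "d \<le> 6 * q + 8 \<Longrightarrow> 2 \<le> c"
      "d \<le> 3 * q + 8 \<Longrightarrow> 3 \<le> c" "d \<le> q + 8 \<Longrightarrow> 4 \<le> c" for c
  proof
    fix v assume "v \<in> leaves_over n M (leaf_position M q y) 0 (M - 1 - d)"
    then show "v \<in> {M..<M + c} \<union> {M + 4..<M + 4 + y}"
    proof (cases rule: leaves_over_cases)
      case 1
      then have "d \<le> 8 * q + 8" using M d by linarith
      then show ?thesis using c(1) 1 by simp
    next
      case 2
      then have "d \<le> 6 * q + 8" using M d by linarith
      then show ?thesis using c(2) 2 by simp
    next
      case 3
      then have "d \<le> 3 * q + 8" using M d by linarith
      then show ?thesis using c(3) 3 by simp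
    next
      case 4
      then have "d \<le> q + 8" using M d by linarith
      then show ?thesis using c(4) 4 by simp
    qed (use d in simp_all)
  qed
  show ?thesis
  proof (cases rule: end_weight_cases[of d q])
    case 1
    show ?thesis unfolding 1(2) by (rule power_card_le[OF sub[of 4], of 4]) simp_all
  next
    case 2
    then show ?thesis unfolding 2(3) by (intro power_card_le[OF sub[of 3], of 3]) simp_all
  next
    case 3
    then show ?thesis unfolding 3(3) by (intro power_card_le[OF sub[of 2], of 2]) simp_all
  next
    case 4
    then show ?thesis unfolding 4(3) by (intro power_card_le[OF sub[of 1], of 1]) simp_all
  next
    case 5
    then show ?thesis unfolding 5(2) by (intro power_card_le[OF sub[of 0], of 0]) simp_all
  qed
qed

lemma middle_weight:
  assumes "1 \<le> a" "b < M - 1"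
  shows "(2::real) ^ card (leaves_over n M (leaf_position M q y) a b) \<le> 16"
proof -
  \<comment> \<open>With both ends cut off only the four inner leaves remain; the empty interval
    fits the form of \<open>power_card_le\<close>.\<close>
  have "leaves_over n M (leaf_position M q y) a b \<subseteq> {M..<M + 4} \<union> {0..<0}"
  proof
    fix v assume "v \<in> leaves_over n M (leaf_position M q y) a b"
    then show "v \<in> {M..<M + 4} \<union> {0..<0}"
      by (cases rule: leaves_over_cases) (use assms in simp_all)
  qed
  from power_card_le[OF this, of 4 0 16] show ?thesis by simp
qed

text \<open>Intervals cut at one end only are indexed by the number \<open>d\<close> of lost spine
  vertices and carry the factor \<open>2 ^ y\<close>. Those cut at both ends number at most
  \<open>n * n\<close> and contribute at most \<open>16 * n\<close> each, without that
  factor.\<close>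

lemma sum_proper_intervals_le:
  assumes M: "M = 9 * q + r + 1" "r < 9" and n: "n = M + 4 + 2 * y"
  shows "(\<Sum>(a, b)\<in>proper_intervals M.
      2 ^ card (leaves_over n M (leaf_position M q y) a b) * real (n - (Suc b - a)))
    \<le> 2 ^ y * (261 * (real q)\<^sup>2 + 882 * real q + 1296 + 32 * real n * real (4 + 2 * y)) + 16 * real n ^ 3"
proof -
  define g where "g = (\<lambda>(a, b). 2 ^ card (leaves_over n M (leaf_position M q y) a b) * real (n - (Suc b - a)))"
  have g0: "0 \<le> g x" for x by (auto simp: g_def case_prod_beta)
  define I1 where "I1 = (\<lambda>d. (d, M - 1)) ` {1..M - 1}"
  define I2 where "I2 = (\<lambda>d. (0::nat, M - 1 - d)) ` {1..M - 1}"
  define I3 where "I3 = {1..<M} \<times> {..<M - 1}"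
  have fin: "finite I1" "finite I2" "finite I3" by (auto simp: I1_def I2_def I3_def)
  have cover: "proper_intervals M \<subseteq> I1 \<union> I2 \<union> I3"
  proof
    fix x assume *: "x \<in> proper_intervals M"
    obtain a b where ab: "x = (a, b)" by (cases x)
    with * have x: "x = (a, b)" "a \<le> b" "b < M" "(a, b) \<noteq> (0, M - 1)"
      by (simp_all add: proper_intervals_def)
    have "a \<noteq> 0 \<or> b \<noteq> M - 1" using x(4) by simp
    then consider "b = M - 1" "1 \<le> a" | "a = 0" "b < M - 1" | "1 \<le> a" "b < M - 1"
      using x(3) by linarith
    then show "x \<in> I1 \<union> I2 \<union> I3"
    proof cases
      case 1
      then show ?thesis using x by (auto simp: I1_def)
    next
      case 2
      then have "x = (0, M - 1 - (M - 1 - b))" "M - 1 - b \<in> {1..M - 1}" using x by auto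
      then show ?thesis unfolding I2_def by blast
    next
      case 3
      then show ?thesis using x by (auto simp: I3_def)
    qed
  qed
  \<comment> \<open>\<open>B\<close> bounds the contribution of one end; each lost segment is
    charged \<open>d\<close> plus all \<open>4 + 2 * y\<close> leaves.\<close>
  define B where "B = 2 ^ y * ((261 * (real q)\<^sup>2 + 882 * real q + 1296) / 2 + 16 * real n * real (4 + 2 * y))"
  have one_side: "(\<Sum>d=1..M-1. 2 ^ y * end_weight q d * real (d + (4 + 2 * y))) \<le> B"
  proof -
    have "(\<Sum>d=1..M-1. 2 ^ y * end_weight q d * real (d + (4 + 2 * y)))
      = 2 ^ y * (\<Sum>d=1..M-1. (real d + real (4 + 2 * y)) * end_weight q d)"
      by (simp add: sum_distrib_left mult_ac)
    also have "\<dots> \<le> 2 ^ y * ((261 * (real q)\<^sup>2 + 882 * real q + 1296) / 2 + 16 * real (M - 1) * real (4 + 2 * y))"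
      by (intro mult_left_mono sum_end_weight_le) (use M in auto)
    also have "\<dots> \<le> B"
      unfolding B_def using n by (intro mult_left_mono add_left_mono mult_right_mono) auto
    finally show ?thesis .
  qed
  have 1: "sum g I1 \<le> B"
  proof -
    have "sum g I1 \<le> sum (g \<circ> (\<lambda>d. (d, M - 1))) {1..M - 1}"
      unfolding I1_def by (rule sum_image_le) (auto simp: g0)
    also have "\<dots> \<le> (\<Sum>d=1..M-1. 2 ^ y * end_weight q d * real (d + (4 + 2 * y)))"
    proof (rule sum_mono)
      fix d assume d: "d \<in> {1..M - 1}"
      then have "n - (Suc (M - 1) - d) = d + (4 + 2 * y)" using n by auto
      then show "(g \<circ> (\<lambda>d. (d, M - 1))) d \<le> 2 ^ y * end_weight q d * real (d + (4 + 2 * y))"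
        using left_cut_weight[OF n, of d q] d unfolding g_def comp_apply case_prod_conv
        by (simp only:) (intro mult_right_mono, auto)
    qed
    finally show ?thesis using one_side by linarith
  qed
  have 2: "sum g I2 \<le> B"
  proof -
    have "sum g I2 \<le> sum (g \<circ> (\<lambda>d. (0, M - 1 - d))) {1..M - 1}"
      unfolding I2_def by (rule sum_image_le) (auto simp: g0)
    also have "\<dots> \<le> (\<Sum>d=1..M-1. 2 ^ y * end_weight q d * real (d + (4 + 2 * y)))"
    proof (rule sum_mono)
      fix d assume d: "d \<in> {1..M - 1}"
      then have "n - (Suc (M - 1 - d) - 0) = d + (4 + 2 * y)" using n by auto
      then show "(g \<circ> (\<lambda>d. (0, M - 1 - d))) d \<le> 2 ^ y * end_weight q d * real (d + (4 + 2 * y))"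
        using right_cut_weight[OF M, of d n y] d unfolding g_def comp_apply case_prod_conv
        by (simp only:) (intro mult_right_mono, auto)
    qed
    finally show ?thesis using one_side by linarith
  qed
  have 3: "sum g I3 \<le> 16 * real n ^ 3"
  proof -
    have "sum g I3 \<le> real (card I3) * (16 * real n)"
    proof (rule sum_bounded_above)
      fix x assume "x \<in> I3"
      then obtain a b where x: "x = (a, b)" "1 \<le> a" "b < M - 1" by (auto simp: I3_def)
      have "2 ^ card (leaves_over n M (leaf_position M q y) a b) * real (n - (Suc b - a)) \<le> 16 * real n"
        by (intro mult_mono middle_weight[OF x(2,3)]) auto
      then show "g x \<le> 16 * real n" by (simp add: g_def x(1))
    qed
    also have "\<dots> \<le> real (n * n) * (16 * real n)"
    proof -
      have "card I3 \<le> n * n" unfolding I3_def card_cartesian_product using n by (intro mult_mono) auto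
      then show ?thesis using of_nat_mono[of "card I3" "n * n", where ?'a = real]
        by (intro mult_right_mono) simp_all
    qed
    finally show ?thesis by (simp add: power3_eq_cube)
  qed
  have "sum g (proper_intervals M) \<le> sum g (I1 \<union> I2 \<union> I3)"
    using fin cover g0 by (intro sum_mono2) auto
  also have "\<dots> \<le> sum g I1 + sum g I2 + sum g I3"
    using sum_Un_le_real[of "I1 \<union> I2" I3 g] sum_Un_le_real[of I1 I2 g] fin g0 by force
  also have "\<dots> \<le> B + B + 16 * real n ^ 3" using 1 2 3 by linarith
  also have "\<dots> = 2 ^ y * (261 * (real q)\<^sup>2 + 882 * real q + 1296 + 32 * real n * real (4 + 2 * y)) + 16 * real n ^ 3"
    by (simp add: B_def algebra_simps)
  finally show ?thesis by (simp add: g_def)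
qed

text \<open>With \<open>2 * x = 4 + 2 * y\<close> leaves, one-sided cuts cost about
  \<open>261 * q^2 * 2 ^ y / 2 ^ (2 * x)\<close>, which is \<open>261 * q^2 * u / 4\<close>. Since
  \<open>q\<close> is at most \<open>n / 9\<close>, this is at most
  \<open>29/36 * n^2 * u\<close>.\<close>

lemma caterpillar_construction:
  fixes n x :: nat
  assumes x: "2 \<le> x" "2 * x + 1 \<le> n"
  defines "u \<equiv> 1 / 2 ^ x :: real"
  shows "\<exists>T :: nat pair_pre_digraph. is_tree T \<and> card (pverts T) = n \<and>
    mean_subtree_order T \<ge> real n - real x - 81 / 100 * (real n)\<^sup>2 * u -
      (25 * real n * u + 324 * u + 16 * real x * real n * u + 16 * real n ^ 3 * u\<^sup>2 + 2 * real x * real n * u\<^sup>2)"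
proof -
  define y where "y = x - 2"
  have xy: "x = y + 2" using x(1) by (simp add: y_def)
  \<comment> \<open>The number divided by \<open>9\<close> is \<open>M - 1\<close>, the index of the
    last spine vertex.\<close>
  define q r where "q = (n - 1 - 2 * x) div 9" and "r = (n - 1 - 2 * x) mod 9"
  define M where "M = 9 * q + r + 1"
  have r: "r < 9" by (simp add: r_def)
  have M: "M = n - 2 * x" using x(2) by (simp add: M_def q_def r_def)
  then have n: "n = M + 4 + 2 * y" using x(2) xy by simp
  let ?h = "leaf_position M q y"
  have h: "?h v < M" for v by (auto simp: leaf_position_def M_def)
  have M0: "0 < M" by (simp add: M_def)
  let ?T = "parent_graph {..<n} (caterpillar_parent M ?h)"
  have tree: "is_tree ?T"
    using caterpillar_parent_less[of M ?h] h n M0 by (intro is_tree_parent_graph) auto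
  define S where "S = (\<Sum>(a, b)\<in>proper_intervals M.
      2 ^ card (leaves_over n M ?h a b) * real (n - (Suc b - a)))"
  have nK: "n = M + 2 * x" using n xy by simp
  have mean: "mean_subtree_order ?T \<ge> real n - real (2 * x) / 2 - (real (2 * x) * real n + S) / 2 ^ (2 * x)"
    unfolding S_def using h M0 nK by (rule mean_subtree_order_caterpillar_ge)
  have Sle: "S \<le> 2 ^ y * (261 * (real q)\<^sup>2 + 882 * real q + 1296 + 32 * real n * real (4 + 2 * y)) + 16 * real n ^ 3"
    unfolding S_def using M_def r n by (rule sum_proper_intervals_le)
  have u: "0 < u" "2 ^ (2 * x) = 1 / u\<^sup>2" "2 ^ y = 1 / (4 * u)"
    by (simp_all add: u_def xy power_add power_mult power2_eq_square power_mult_distrib[symmetric])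
  have q: "9 * real q \<le> real n" using M_def nK by simp
  have q2: "81 * (real q)\<^sup>2 \<le> (real n)\<^sup>2"
    using power_mono[OF q, of 2] by (simp add: power_mult_distrib)
  have "(real (2 * x) * real n + S) / 2 ^ (2 * x) = (2 * real x * real n + S) * u\<^sup>2"
    by (simp add: u(2))
  also have "\<dots> \<le> (2 * real x * real n + (1 / (4 * u) * (261 * (real q)\<^sup>2 + 882 * real q + 1296 +
      64 * real n * real x) + 16 * real n ^ 3)) * u\<^sup>2"
    using Sle unfolding u(3) by (intro mult_right_mono add_left_mono) (simp_all add: xy algebra_simps)
  also have "\<dots> = (261 * (real q)\<^sup>2 + 882 * real q + 1296 + 64 * real n * real x) * u / 4
      + 16 * real n ^ 3 * u\<^sup>2 + 2 * real x * real n * u\<^sup>2"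
    using u(1) by (simp add: field_simps power2_eq_square)
  also have "\<dots> \<le> (81 * 4 / 100 * (real n)\<^sup>2 + 100 * real n + 1296 + 64 * real n * real x) * u / 4
      + 16 * real n ^ 3 * u\<^sup>2 + 2 * real x * real n * u\<^sup>2"
  proof -
    \<comment> \<open>This rests on \<open>261 / 81 < 3.24 = 4 * 0.81\<close> and
      \<open>882 / 9 = 98 \<le> 100\<close>.\<close>
    have "261 * (real q)\<^sup>2 + 882 * real q + 1296 + 64 * real n * real x
       \<le> 81 * 4 / 100 * (real n)\<^sup>2 + 100 * real n + 1296 + 64 * real n * real x"
      using q q2 zero_le_power2[of "real n"] by linarith
    then show ?thesis using u(1) by (intro add_right_mono divide_right_mono mult_right_mono) auto
  qed
  also have "\<dots> = 81 / 100 * (real n)\<^sup>2 * u +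
      (25 * real n * u + 324 * u + 16 * real x * real n * u + 16 * real n ^ 3 * u\<^sup>2 + 2 * real x * real n * u\<^sup>2)"
    by (simp add: algebra_simps)
  finally have "(real (2 * x) * real n + S) / 2 ^ (2 * x) \<le> 81 / 100 * (real n)\<^sup>2 * u +
      (25 * real n * u + 324 * u + 16 * real x * real n * u + 16 * real n ^ 3 * u\<^sup>2 + 2 * real x * real n * u\<^sup>2)" .
  then have "mean_subtree_order ?T \<ge> real n - real x - 81 / 100 * (real n)\<^sup>2 * u -
      (25 * real n * u + 324 * u + 16 * real x * real n * u + 16 * real n ^ 3 * u\<^sup>2 + 2 * real x * real n * u\<^sup>2)"
    using mean by simp
  with tree show ?thesis by (intro exI[of _ ?T]) simp
qed

section \<open>Asymptotics\<close>

text \<open>Natural shifts suffice: for a negative floor one shifts from \<open>x\<close> up to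
  \<open>frac x\<close>.\<close>

lemma periodic_frac:
  fixes f :: "real \<Rightarrow> 'a"
  assumes f: "\<And>x. f (x + 1) = f x"
  shows "f x = f (frac x)"
proof -
  have nat: "f (y + real k) = f y" for y k
  proof (induction k)
    case (Suc k)
    then show ?case using f[of "y + real k"] by (simp add: algebra_simps)
  qed simp
  show ?thesis
  proof (cases "0 \<le> \<lfloor>x\<rfloor>")
    case True
    then show ?thesis using nat[of "frac x" "nat \<lfloor>x\<rfloor>"] by (simp add: frac_def)
  next
    case False
    then show ?thesis using nat[of x "nat (- \<lfloor>x\<rfloor>)"] by (simp add: frac_def)
  qed
qed

text \<open>With \<open>t = N * u \<le> 3 / N\<close>, the sum is at most
  \<open>(25 + 324 + 48) * t + (16 + 6) * (x * t)\<close>, and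
  \<open>x * t \<le> 12 * (l / N)\<close>. Hence \<open>397 * 3 = 1191\<close> and
  \<open>22 * 12 = 264\<close>.\<close>

lemma error_terms_le:
  fixes N u x l :: real
  assumes N: "1 \<le> N" and u: "0 \<le> u" "N\<^sup>2 * u \<le> 3" and x: "0 \<le> x" "x \<le> 4 * l"
  shows "25 * N * u + 324 * u + 16 * x * N * u + 16 * N ^ 3 * u\<^sup>2 + 2 * x * N * u\<^sup>2
    \<le> 1191 / N + 264 * (l / N)"
proof -
  define t where "t = N * u"
  have t0: "0 \<le> t" using N u(1) by (simp add: t_def)
  have Nt: "N * t \<le> 3" using u(2) by (simp add: t_def power2_eq_square mult.assoc)
  have tN: "t \<le> 3 / N" using Nt N by (simp add: field_simps)
  have ut: "u \<le> t" using mult_right_mono[OF N u(1)] by (simp add: t_def)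
  have t3: "t \<le> 3" using mult_right_mono[OF N t0] Nt by simp
  have "16 * N ^ 3 * u\<^sup>2 = 16 * (N * t) * t"
    by (simp add: t_def power2_eq_square power3_eq_cube)
  also have "\<dots> \<le> 16 * 3 * t" using Nt t0 by (intro mult_right_mono mult_left_mono) auto
  finally have 1: "16 * N ^ 3 * u\<^sup>2 \<le> 48 * t" by simp
  have "2 * x * N * u\<^sup>2 = (2 * x * t) * u" by (simp add: t_def power2_eq_square)
  also have "\<dots> \<le> (2 * x * t) * 3" using ut t3 x(1) t0 by (intro mult_left_mono) auto
  finally have 2: "2 * x * N * u\<^sup>2 \<le> 6 * (x * t)" by simp
  have "x * t \<le> (4 * l) * (3 / N)" using x tN t0 by (intro mult_mono) auto
  then have 3: "x * t \<le> 12 * (l / N)" by simp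
  have "25 * N * u + 324 * u + 16 * x * N * u = 25 * t + 324 * u + 16 * (x * t)"
    by (simp add: t_def)
  moreover have "1191 / N = 397 * (3 / N)" by simp
  ultimately show ?thesis using 1 2 3 ut tN by linarith
qed

text \<open>For \<open>x\<close> the floor of \<open>L = 2 * log 2 (0.9 * n)\<close>, the loss
  \<open>0.81 * n^2 / 2 ^ x\<close> equals \<open>2 powr frac L\<close> exactly, so only the error
  terms remain.\<close>

lemma caterpillar_construction_asymptotic:
  "\<exists>\<epsilon> :: nat \<Rightarrow> real. \<epsilon> \<longlonglongrightarrow> 0 \<and>
    (\<forall>\<^sub>F n in sequentially. \<exists>T :: nat pair_pre_digraph.
       is_tree T \<and> card (pverts T) = n \<and>
       mean_subtree_order T \<ge> real n - of_int \<lfloor>2 * log 2 (0.9 * real n)\<rfloor>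
         - 2 powr frac (2 * log 2 (0.9 * real n)) - \<epsilon> n)"
proof -
  let ?L = "\<lambda>n::nat. 2 * log 2 (0.9 * real n)"
  define \<epsilon> where "\<epsilon> n = 1191 / real n + 264 * (ln (real n) / real n)" for n :: nat
  have ln_over_n: "(\<lambda>n. ln (real n) / real n) \<longlonglongrightarrow> 0"
    by (rule filterlim_compose[OF ln_x_over_x_tendsto_0 filterlim_real_sequentially])
  have "\<epsilon> \<longlonglongrightarrow> 0 + 264 * 0"
    unfolding \<epsilon>_def by (intro tendsto_add tendsto_mult tendsto_const lim_const_over_n ln_over_n)
  then have "\<epsilon> \<longlonglongrightarrow> 0" by simp
  moreover have "\<forall>\<^sub>F n in sequentially. \<exists>T :: nat pair_pre_digraph.
       is_tree T \<and> card (pverts T) = n \<and>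
       mean_subtree_order T \<ge> real n - of_int \<lfloor>?L n\<rfloor> - 2 powr frac (?L n) - \<epsilon> n"
  proof -
    \<comment> \<open>The bound \<open>1 / 16\<close> yields \<open>8 * ln n + 1 \<le> n\<close>,
      which makes room for \<open>2 * x\<close> leaves because \<open>x \<le> 4 * ln n\<close>. From
      \<open>n = 3\<close> on, \<open>0.9 * n \<ge> 2\<close> and thus
      \<open>x \<ge> 2\<close>.\<close>
    have "\<forall>\<^sub>F n in sequentially. ln (real n) / real n < 1 / 16"
      using ln_over_n by (rule order_tendstoD) simp
    with eventually_ge_at_top[of 3] show ?thesis
    proof eventually_elim
      case (elim n)
      have ln: "8 * ln (real n) + 1 \<le> real n"
        using elim by (simp add: field_simps)
      have L2: "2 \<le> ?L n" using elim(1) by (simp add: le_log_iff)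
      have L3: "?L n \<le> 4 * ln (real n)"
      proof -
        \<comment> \<open>As \<open>exp 1 \<le> 4\<close>, \<open>ln 2\<close> is at least
          \<open>1/2\<close>, so \<open>log 2 n\<close> is at most \<open>2 * ln n\<close>.\<close>
        have "1 \<le> ln (2 ^ 2 :: real)" using exp_le by (subst ln_ge_iff) auto
        then have ln2: "1 \<le> 2 * ln (2 :: real)" unfolding ln_realpow by simp
        have "log 2 (0.9 * real n) \<le> log 2 (real n)" using elim(1) by simp
        moreover have "ln (real n) * 2 \<le> ln (real n) * (4 * ln 2)"
          using ln2 elim(1) by (intro mult_left_mono) auto
        then have "2 * log 2 (real n) \<le> 4 * ln (real n)"
          by (simp add: log_def divide_le_eq)
        ultimately show ?thesis by linarith
      qed
      define x where "x = nat \<lfloor>?L n\<rfloor>"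
      define u where "u = (1 / 2 ^ x :: real)"
      have xL: "real x \<le> ?L n" "?L n < real x + 1"
        using L2 unfolding x_def by linarith+
      have x2: "2 \<le> x" using L2 by (simp add: x_def le_nat_floor)
      have xn: "2 * x + 1 \<le> n"
      proof -
        have "real (2 * x + 1) \<le> real n" using xL L3 ln by simp
        then show ?thesis by (simp only: of_nat_le_iff)
      qed
      have pow: "2 powr ?L n = 81 / 100 * (real n)\<^sup>2"
      proof -
        have "2 powr ?L n = (2 powr log 2 (0.9 * real n)) powr 2" by (simp add: powr_powr mult.commute)
        also have "\<dots> = (0.9 * real n)\<^sup>2" using elim(1) by simp
        finally show ?thesis by (simp add: power_mult_distrib power2_eq_square)
      qed
      have frac_L: "frac (?L n) = ?L n - real x" "of_int \<lfloor>?L n\<rfloor> = real x"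
        using L2 by (simp_all add: x_def frac_def)
      have frac: "2 powr frac (?L n) = 81 / 100 * (real n)\<^sup>2 * u"
        unfolding frac_L powr_diff pow by (simp add: u_def powr_realpow)
      have u0: "0 \<le> u" by (simp add: u_def)
      have "81 / 100 * (real n)\<^sup>2 * u \<le> 2 powr 1"
        unfolding frac[symmetric] by (intro powr_mono less_imp_le frac_lt_1) simp
      \<comment> \<open>The constant \<open>3\<close> rounds up \<open>2 / 0.81\<close>.\<close>
      then have u3: "(real n)\<^sup>2 * u \<le> 3" by simp
      have err: "25 * real n * u + 324 * u + 16 * real x * real n * u + 16 * real n ^ 3 * u\<^sup>2
          + 2 * real x * real n * u\<^sup>2 \<le> \<epsilon> n"
        unfolding \<epsilon>_def using elim(1) u0 u3 xL(1) L3 by (intro error_terms_le) auto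
      obtain T :: "nat pair_pre_digraph" where T: "is_tree T" "card (pverts T) = n"
        "mean_subtree_order T \<ge> real n - real x - 81 / 100 * (real n)\<^sup>2 * u -
          (25 * real n * u + 324 * u + 16 * real x * real n * u + 16 * real n ^ 3 * u\<^sup>2 + 2 * real x * real n * u\<^sup>2)"
        using caterpillar_construction[OF x2 xn] unfolding u_def by blast
      then have "mean_subtree_order T \<ge> real n - of_int \<lfloor>?L n\<rfloor> - 2 powr frac (?L n) - \<epsilon> n"
        using frac frac_L(2) err by linarith
      with T show ?case by blast
    qed
  qed
  ultimately show ?thesis by blast
qed

text \<open>The two hypotheses agree at the ends of the closed unit interval, where the formula
  gives \<open>-1\<close> both times, and together they determine \<open>f\<close>. They turn
  \<open>x - f x\<close> into the floor of \<open>x\<close> plus \<open>2 powr frac x\<close>, the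
  form of the asymptotic bound.\<close>

theorem theorem5p1:
  fixes f :: "real \<Rightarrow> real"
  assumes f_periodic: "\<And>x. f (x + 1) = f x"
    and f_unit: "\<And>x. x \<in> {0..1} \<Longrightarrow> f x = x - 2 powr x"
  shows "\<exists>\<epsilon> :: nat \<Rightarrow> real. \<epsilon> \<longlonglongrightarrow> 0 \<and>
    (\<forall>\<^sub>F n in sequentially. \<exists>T :: nat pair_pre_digraph.
       is_tree T \<and> card (pverts T) = n \<and>
       mean_subtree_order T \<ge>
         real n - 2 * log 2 (0.9 * real n) + f (2 * log 2 (0.9 * real n)) - \<epsilon> n)"
proof -
  have f_eq: "x - f x = of_int \<lfloor>x\<rfloor> + 2 powr frac x" for x
    using periodic_frac[of f x, OF f_periodic] f_unit[of "frac x"] frac_lt_1[of x]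
    by (simp add: frac_def)
  have "real n - x + f x - e = real n - of_int \<lfloor>x\<rfloor> - 2 powr frac x - e" for n x e
    using f_eq[of x] by linarith
  then show ?thesis
    by (simp only: caterpillar_construction_asymptotic)
qed

end
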